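(* Let $n$ be a non-negative integer and let $f,g:\{0,1\}^n\to[0,1]$. Then $$\|f*g\|_2^2\ \le\ \tfrac12\bigl(\langle f,g\rangle+\mathbb{E}[f]\,\mathbb{E}[g]\bigr).$$ Moreover, if $f,g:\{0,1\}^n\to\{0,1\}$ are Boolean-valued, then equality holds in this inequality if and only if one of the following alternatives holds: (1) $f\equiv0$ or $g\equiv0$; (2) $f\equiv g\equiv1$; (3) the sets $\mathrm{supp}(f)$ and $\mathrm{supp}(g)$ are complementary cosets of an index-two subgroup of the group $(\{0,1\}^n,\oplus)$.
   Context: The cube $\{0,1\}^n$ carries the uniform probability measure, with expectation $\mathbb{E}$; $\langle f,g\rangle:=\mathbb{E}[fg]$ and $\|f\|_2^2:=\mathbb{E}[f^2]$. $\oplus$ is coordinatewise addition modulo $2$. The normalized convolution is $(f*g)(z):=\mathbb{E}_x[f(x)g(x\oplus z)]$ for $z\in\{0,1\}^n$, with $x$ uniform on $\{0,1\}^n$. $\mathrm{supp}(f)=\{x: f(x)\ne 0\}$. *)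

theory Defs
  imports "HOL-Probability.Probability" "HOL-Algebra.Coset" "HOL-Library.Z2"
begin

(* Points of the cube are lists over the two-element field bit, so that n = 0 (a single
   point) is covered.  Functions on the cube are total functions on lists; every notion
   below reads their values on cube n only. *)

definition cube :: "nat \<Rightarrow> bit list set" where
  "cube n = {x. length x = n}"

definition cube_add :: "bit list \<Rightarrow> bit list \<Rightarrow> bit list" where
  "cube_add x y = map2 (+) x y"

definition cube_group :: "nat \<Rightarrow> bit list monoid" where
  "cube_group n = \<lparr>carrier = cube n, mult = cube_add, one = replicate n 0\<rparr>"

definition cube_expect :: "nat \<Rightarrow> (bit list \<Rightarrow> real) \<Rightarrow> real" where
  "cube_expect n f = measure_pmf.expectation (pmf_of_set (cube n)) f"

definition cube_inner :: "nat \<Rightarrow> (bit list \<Rightarrow> real) \<Rightarrow> (bit list \<Rightarrow> real) \<Rightarrow> real" where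
  "cube_inner n f g = cube_expect n (\<lambda>x. f x * g x)"

definition cube_norm_sq :: "nat \<Rightarrow> (bit list \<Rightarrow> real) \<Rightarrow> real" where
  "cube_norm_sq n f = cube_expect n (\<lambda>x. (f x)\<^sup>2)"

definition cube_conv ::
  "nat \<Rightarrow> (bit list \<Rightarrow> real) \<Rightarrow> (bit list \<Rightarrow> real) \<Rightarrow> bit list \<Rightarrow> real" where
  "cube_conv n f g z = cube_expect n (\<lambda>x. f x * g (cube_add x z))"

definition cube_supp :: "nat \<Rightarrow> (bit list \<Rightarrow> real) \<Rightarrow> bit list set" where
  "cube_supp n f = {x \<in> cube n. f x \<noteq> 0}"

definition complementary_cosets_index_two ::
  "nat \<Rightarrow> bit list set \<Rightarrow> bit list set \<Rightarrow> bool" where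
  "complementary_cosets_index_two n A B \<longleftrightarrow>
     (\<exists>H. subgroup H (cube_group n) \<and> card (rcosets\<^bsub>cube_group n\<^esub> H) = 2 \<and>
          A \<in> rcosets\<^bsub>cube_group n\<^esub> H \<and> B \<in> rcosets\<^bsub>cube_group n\<^esub> H \<and> B = cube n - A)"

lemma finite_cube: "finite (cube n)"
proof -
  have "finite (UNIV :: bit set)"
    by (rule finite_subset[of _ "{0, 1}"]) (auto intro: bit.exhaust)
  then show ?thesis
    using finite_lists_length_eq[of "UNIV :: bit set" n] by (simp add: cube_def)
qed

lemma card_cube: "card (cube n) = 2 ^ n"
proof -
  have U: "(UNIV :: bit set) = {0, 1}"
    by (auto intro: bit.exhaust)
  have "finite (UNIV :: bit set)" "card (UNIV :: bit set) = 2"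
    unfolding U by auto
  then show ?thesis
    using card_lists_length_eq[of "UNIV :: bit set" n] by (simp add: cube_def)
qed

lemma cube_expect_eq_sum: "cube_expect n f = (\<Sum>x\<in>cube n. f x) / 2 ^ n"
proof -
  have "cube n \<noteq> {}"
    using card_cube[of n] by auto
  then show ?thesis
    by (simp add: cube_expect_def integral_pmf_of_set finite_cube card_cube)
qed

lemma comm_group_cube_group: "comm_group (cube_group n)"
proof (rule comm_groupI)
  fix x y z
  assume "x \<in> carrier (cube_group n)" "y \<in> carrier (cube_group n)" "z \<in> carrier (cube_group n)"
  then show "x \<otimes>\<^bsub>cube_group n\<^esub> y \<otimes>\<^bsub>cube_group n\<^esub> z
      = x \<otimes>\<^bsub>cube_group n\<^esub> (y \<otimes>\<^bsub>cube_group n\<^esub> z)"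
    by (auto simp: cube_group_def cube_def cube_add_def add.assoc intro!: nth_equalityI)
next
  fix x
  assume x: "x \<in> carrier (cube_group n)"
  then have "x \<otimes>\<^bsub>cube_group n\<^esub> x = \<one>\<^bsub>cube_group n\<^esub>"
    by (auto simp: cube_group_def cube_def cube_add_def intro!: nth_equalityI)
  then show "\<exists>y\<in>carrier (cube_group n). y \<otimes>\<^bsub>cube_group n\<^esub> x = \<one>\<^bsub>cube_group n\<^esub>"
    using x by blast
qed (auto simp: cube_group_def cube_def cube_add_def add.commute intro!: nth_equalityI)

end

theory Submission
  imports Defs
begin

text \<open>
  Write \<open>h = f * g\<close>, \<open>\<alpha> = E[f]\<close>, \<open>\<beta> = E[g]\<close>, \<open>\<delta> = \<langle>f, g\<rangle>\<close>.  Pointwise \<open>0 \<le> h \<le> min \<alpha> \<beta>\<close>, and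
  \<open>E[h] = \<alpha> \<beta>\<close>, so \<open>E[h\<^sup>2] \<le> min \<alpha> \<beta> \<cdot> \<alpha> \<beta>\<close>.  Since \<open>(1 - f) (1 - g) \<ge> 0\<close>, we have
  \<open>min \<alpha> \<beta> \<le> (\<alpha> + \<beta>) / 2 \<le> (1 + \<delta>) / 2\<close>, and \<open>\<alpha> \<beta> \<delta> \<le> \<delta>\<close> gives the inequality.  If equality holds
  and \<open>\<alpha>, \<beta>, \<delta>\<close> do not fall under the trivial cases, then \<open>\<delta> = 0\<close>, \<open>\<alpha> = \<beta> = 1/2\<close>, \<open>f + g = 1\<close>,
  and \<open>h\<close> takes only the values \<open>0\<close> and \<open>1/2\<close>; hence each translate of the support of \<open>f\<close> is
  either itself or its complement, which makes both supports cosets of one subgroup.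
\<close>

section \<open>Expectation and convolution\<close>

lemma cube_add_closed: "x \<in> cube n \<Longrightarrow> y \<in> cube n \<Longrightarrow> cube_add x y \<in> cube n"
  by (simp add: cube_def cube_add_def)

lemma cube_add_commute: "x \<in> cube n \<Longrightarrow> y \<in> cube n \<Longrightarrow> cube_add x y = cube_add y x"
  by (auto simp: cube_def cube_add_def add.commute intro!: nth_equalityI)

lemma cube_add_assoc:
  "x \<in> cube n \<Longrightarrow> y \<in> cube n \<Longrightarrow> z \<in> cube n \<Longrightarrow>
    cube_add (cube_add x y) z = cube_add x (cube_add y z)"
  by (auto simp: cube_def cube_add_def add.assoc intro!: nth_equalityI)

lemma cube_add_cancel_right:
  "x \<in> cube n \<Longrightarrow> y \<in> cube n \<Longrightarrow> cube_add (cube_add x y) y = x"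
  by (auto simp: cube_def cube_add_def add.assoc intro!: nth_equalityI)

lemma cube_add_cancel_left:
  "x \<in> cube n \<Longrightarrow> y \<in> cube n \<Longrightarrow> cube_add x (cube_add x y) = y"
  by (auto simp: cube_def cube_add_def add.assoc[symmetric] intro!: nth_equalityI)

section \<open>Averages over the cube and their invariance under translation\<close>

lemma cube_expect_cong:
  "(\<And>x. x \<in> cube n \<Longrightarrow> u x = v x) \<Longrightarrow> cube_expect n u = cube_expect n v"
  by (simp add: cube_expect_eq_sum)

lemma cube_expect_mono:
  "(\<And>x. x \<in> cube n \<Longrightarrow> u x \<le> v x) \<Longrightarrow> cube_expect n u \<le> cube_expect n v"
  by (simp add: cube_expect_eq_sum divide_right_mono sum_mono)

lemma cube_expect_const: "cube_expect n (\<lambda>x. c) = c"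
  by (simp add: cube_expect_eq_sum card_cube)

lemma cube_expect_add: "cube_expect n (\<lambda>x. u x + v x) = cube_expect n u + cube_expect n v"
  by (simp add: cube_expect_eq_sum sum.distrib add_divide_distrib)

lemma cube_expect_diff: "cube_expect n (\<lambda>x. u x - v x) = cube_expect n u - cube_expect n v"
  by (simp add: cube_expect_eq_sum sum_subtractf diff_divide_distrib)

lemma cube_expect_mult_left: "cube_expect n (\<lambda>x. c * u x) = c * cube_expect n u"
  by (simp add: cube_expect_eq_sum sum_distrib_left)

lemma cube_expect_nonneg: "(\<And>x. x \<in> cube n \<Longrightarrow> 0 \<le> u x) \<Longrightarrow> 0 \<le> cube_expect n u"
  by (simp add: cube_expect_eq_sum sum_nonneg)

text \<open>This turns equality between averages into pointwise identities; every rigidity argument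
  in the equality case goes through it.\<close>

lemma cube_expect_eq_0_iff:
  "(\<And>x. x \<in> cube n \<Longrightarrow> 0 \<le> u x) \<Longrightarrow> cube_expect n u = 0 \<longleftrightarrow> (\<forall>x\<in>cube n. u x = 0)"
  by (simp add: cube_expect_eq_sum sum_nonneg_eq_0_iff finite_cube)

lemma bij_betw_cube_add:
  "z \<in> cube n \<Longrightarrow> bij_betw (\<lambda>x. cube_add x z) (cube n) (cube n)"
  by (rule bij_betwI[where g = "\<lambda>x. cube_add x z"])
    (auto simp: cube_add_closed cube_add_cancel_right)

lemma cube_expect_translate:
  "z \<in> cube n \<Longrightarrow> cube_expect n (\<lambda>x. u (cube_add x z)) = cube_expect n u"
  using sum.reindex_bij_betw[OF bij_betw_cube_add, of z n u] by (simp add: cube_expect_eq_sum)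

lemma cube_expect_swap:
  "cube_expect n (\<lambda>x. cube_expect n (\<lambda>y. u x y)) = cube_expect n (\<lambda>y. cube_expect n (\<lambda>x. u x y))"
  unfolding cube_expect_eq_sum sum_divide_distrib[symmetric] by (subst sum.swap) (rule refl)

section \<open>Convolution: symmetry, mean, pointwise bounds and second moment\<close>

lemma cube_conv_commute:
  assumes "z \<in> cube n"
  shows "cube_conv n g f z = cube_conv n f g z"
proof -
  have "cube_conv n f g z = cube_expect n (\<lambda>x. f (cube_add x z) * g (cube_add (cube_add x z) z))"
    unfolding cube_conv_def
    by (rule cube_expect_translate[OF assms, of "\<lambda>x. f x * g (cube_add x z)", symmetric])
  also have "\<dots> = cube_conv n g f z"
    unfolding cube_conv_def
    by (rule cube_expect_cong) (simp add: cube_add_cancel_right[OF _ assms] mult.commute)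
  finally show ?thesis by simp
qed

text \<open>After exchanging the two averages, \<open>x\<close> is fixed and \<open>z\<close> runs
  over the cube; so does \<open>cube_add x z\<close>, and the inner average becomes the mean of
  \<open>g\<close>.\<close>

lemma cube_expect_conv: "cube_expect n (cube_conv n f g) = cube_expect n f * cube_expect n g"
proof -
  have "cube_expect n (cube_conv n f g)
      = cube_expect n (\<lambda>x. cube_expect n (\<lambda>z. f x * g (cube_add x z)))"
    unfolding cube_conv_def by (rule cube_expect_swap)
  also have "\<dots> = cube_expect n (\<lambda>x. f x * cube_expect n g)"
  proof (rule cube_expect_cong)
    fix x assume x: "x \<in> cube n"
    have "cube_expect n (\<lambda>z. g (cube_add x z)) = cube_expect n (\<lambda>z. g (cube_add z x))"
      by (rule cube_expect_cong) (simp add: cube_add_commute[OF x])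
    then show "cube_expect n (\<lambda>z. f x * g (cube_add x z)) = f x * cube_expect n g"
      by (simp add: cube_expect_mult_left cube_expect_translate[OF x])
  qed
  also have "\<dots> = cube_expect n f * cube_expect n g"
    using cube_expect_mult_left[of n "cube_expect n g" f] by (simp add: mult.commute)
  finally show ?thesis .
qed

lemma cube_conv_nonneg:
  assumes "\<forall>x\<in>cube n. 0 \<le> f x" "\<forall>x\<in>cube n. 0 \<le> g x" "z \<in> cube n"
  shows "0 \<le> cube_conv n f g z"
  unfolding cube_conv_def using assms by (intro cube_expect_nonneg) (simp add: cube_add_closed)

lemma cube_conv_le_left:
  assumes "\<forall>x\<in>cube n. 0 \<le> f x" "\<forall>x\<in>cube n. g x \<le> 1" "z \<in> cube n"
  shows "cube_conv n f g z \<le> cube_expect n f"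
  unfolding cube_conv_def
  using assms by (intro cube_expect_mono) (simp add: cube_add_closed mult_left_le)

lemma cube_conv_le_right:
  assumes "\<forall>x\<in>cube n. f x \<le> 1" "\<forall>x\<in>cube n. 0 \<le> g x" "z \<in> cube n"
  shows "cube_conv n f g z \<le> cube_expect n g"
  using cube_conv_le_left[of n g f z] assms by (simp add: cube_conv_commute)

text \<open>In the square of the convolution one factor is bounded uniformly by the smaller mean;
  the other is nonnegative and is averaged exactly.\<close>

lemma cube_norm_sq_conv_le:
  assumes f: "\<forall>x\<in>cube n. f x \<in> {0..1}" and g: "\<forall>x\<in>cube n. g x \<in> {0..1}"
  shows "cube_norm_sq n (cube_conv n f g)
    \<le> min (cube_expect n f) (cube_expect n g) * (cube_expect n f * cube_expect n g)"
proof -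
  let ?m = "min (cube_expect n f) (cube_expect n g)"
  have "cube_norm_sq n (cube_conv n f g) \<le> cube_expect n (\<lambda>z. ?m * cube_conv n f g z)"
    unfolding cube_norm_sq_def power2_eq_square
    using f g
    by (intro cube_expect_mono mult_right_mono)
      (simp_all add: cube_conv_nonneg cube_conv_le_left cube_conv_le_right)
  then show ?thesis
    by (simp add: cube_expect_mult_left cube_expect_conv)
qed

text \<open>Used twice: nonnegativity of the left side bounds the sum of the means, and its
  vanishing in the equality case pins down \<open>f\<close> and \<open>g\<close> pointwise.\<close>

lemma cube_expect_one_minus_prod:
  "cube_expect n (\<lambda>x. (1 - f x) * (1 - g x))
    = 1 - cube_expect n f - cube_expect n g + cube_inner n f g"
proof -
  have "cube_expect n (\<lambda>x. (1 - f x) * (1 - g x)) = cube_expect n (\<lambda>x. (1 - f x - g x) + f x * g x)"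
    by (rule cube_expect_cong) (simp add: algebra_simps)
  then show ?thesis
    by (simp add: cube_inner_def cube_expect_add cube_expect_diff cube_expect_const)
qed

section \<open>Complementary cosets of an index-two subgroup\<close>

text \<open>For a nonempty subset of a cube this says that it is a coset of a subgroup (an affine
  subspace over the two-element field), without naming the subgroup. The empty set also qualifies,
  so nonemptiness is tracked separately.\<close>

definition ternary_closed :: "bit list set \<Rightarrow> bool" where
  "ternary_closed S \<longleftrightarrow> (\<forall>x\<in>S. \<forall>y\<in>S. \<forall>z\<in>S. cube_add (cube_add x y) z \<in> S)"

lemma ternary_closedD:
  "ternary_closed S \<Longrightarrow> x \<in> S \<Longrightarrow> y \<in> S \<Longrightarrow> z \<in> S \<Longrightarrow> cube_add (cube_add x y) z \<in> S"
  by (simp add: ternary_closed_def)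

text \<open>Translation by \<open>cube_add x y\<close> is an involution that maps \<open>S\<close>
  into itself, hence it also preserves the complement.\<close>

lemma ternary_closed_notin:
  assumes S: "ternary_closed S" "S \<subseteq> cube n" and x: "x \<in> S" "y \<in> S" and z: "z \<in> cube n" "z \<notin> S"
  shows "cube_add (cube_add x y) z \<notin> S"
proof
  assume "cube_add (cube_add x y) z \<in> S"
  then have "cube_add (cube_add x y) (cube_add (cube_add x y) z) \<in> S"
    using S(1) x by (simp add: ternary_closedD)
  moreover have "cube_add (cube_add x y) (cube_add (cube_add x y) z) = z"
    using S x z by (intro cube_add_cancel_left[of _ n] cube_add_closed) auto
  ultimately show False using z by simp
qed

text \<open>Three elements h + c, k + c, l + c of a coset sum to (h + k + l) + c, because c + c =
  0.\<close>

lemma complementary_cosets_index_two_imp_ternary_closed: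
  assumes "complementary_cosets_index_two n A B"
  shows "ternary_closed A \<and> ternary_closed B \<and> A \<noteq> {} \<and> B \<noteq> {} \<and> A \<subseteq> cube n \<and> B = cube n - A"
proof -
  let ?G = "cube_group n"
  interpret comm_group ?G by (rule comm_group_cube_group)
  have car: "carrier ?G = cube n" and mul: "\<And>x y. x \<otimes>\<^bsub>?G\<^esub> y = cube_add x y"
    by (simp_all add: cube_group_def)
  obtain H where H: "subgroup H ?G" and A: "A \<in> rcosets\<^bsub>?G\<^esub> H" and B: "B \<in> rcosets\<^bsub>?G\<^esub> H"
    and compl: "B = cube n - A"
    using assms unfolding complementary_cosets_index_two_def by blast
  have coset: "ternary_closed C \<and> C \<noteq> {} \<and> C \<subseteq> cube n" if C: "C \<in> rcosets\<^bsub>?G\<^esub> H" for C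
  proof -
    obtain c where c: "c \<in> cube n" and C_eq: "C = H #>\<^bsub>?G\<^esub> c"
      using C by (auto simp: RCOSETS_def car)
    have "ternary_closed C"
      unfolding ternary_closed_def
    proof (intro ballI)
      fix x y z assume "x \<in> C" "y \<in> C" "z \<in> C"
      then obtain h k l where h: "h \<in> H" "k \<in> H" "l \<in> H"
        and eq: "x = cube_add h c" "y = cube_add k c" "z = cube_add l c"
        by (auto simp: C_eq r_coset_def mul)
      have cube: "h \<in> cube n" "k \<in> cube n" "l \<in> cube n"
        using h subgroup.subset[OF H] car by auto
      have "cube_add (cube_add x y) z = cube_add (cube_add (cube_add h k) l) c"
        using cube c unfolding eq
        by (auto simp: cube_def cube_add_def ac_simps intro!: nth_equalityI)
      moreover have "cube_add (cube_add h k) l \<in> H"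
        using h subgroup.m_closed[OF H] by (simp add: mul)
      ultimately show "cube_add (cube_add x y) z \<in> C"
        by (auto simp: C_eq r_coset_def mul)
    qed
    moreover have "C \<noteq> {}"
      using subgroup.one_closed[OF H] by (auto simp: C_eq r_coset_def)
    moreover have "C \<subseteq> cube n"
      using r_coset_subset_G[OF subgroup.subset[OF H], of c] c by (simp add: car C_eq)
    ultimately show ?thesis by blast
  qed
  show ?thesis using coset[OF A] coset[OF B] compl by blast
qed

text \<open>Ternary closure of \<open>A\<close> makes a translate of \<open>A\<close> a subgroup;
  ternary closure of the complement \<open>B\<close> forces \<open>B\<close> to be a single further
  coset.\<close>

lemma complementary_cosets_index_twoI:
  assumes A: "ternary_closed A" "A \<noteq> {}" "A \<subseteq> cube n"
    and B: "ternary_closed B" "B \<noteq> {}" "B = cube n - A"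
  shows "complementary_cosets_index_two n A B"
proof -
  let ?G = "cube_group n"
  interpret comm_group ?G by (rule comm_group_cube_group)
  have car: "carrier ?G = cube n" and mul: "\<And>x y. x \<otimes>\<^bsub>?G\<^esub> y = cube_add x y"
    and one: "\<one>\<^bsub>?G\<^esub> = replicate n 0"
    by (simp_all add: cube_group_def)
  have B_sub: "B \<subseteq> cube n" using B by blast
  obtain a b where a: "a \<in> A" and b: "b \<in> B" using A B by blast
  have ac: "a \<in> cube n" using a A by blast
  \<comment> \<open>The translate of \<open>A\<close> that carries the base point \<open>a\<close>
    to the identity.\<close>
  define H where "H = {h \<in> cube n. cube_add h a \<in> A}"
  have self: "cube_add x x = \<one>\<^bsub>?G\<^esub>" if "x \<in> cube n" for x
    using that by (auto simp: one cube_def cube_add_def intro!: nth_equalityI)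
  have H: "subgroup H ?G"
  proof (rule subgroupI)
    show "H \<subseteq> carrier ?G" by (auto simp: H_def car)
    have "\<one>\<^bsub>?G\<^esub> \<in> H"
      using a ac l_one[of a] one_closed by (simp add: H_def car mul del: one_closed)
    then show "H \<noteq> {}" by blast
  next
    fix h assume h: "h \<in> H"
    then have "inv\<^bsub>?G\<^esub> h = h"
      by (intro inv_equality) (auto simp: H_def car mul self)
    then show "inv\<^bsub>?G\<^esub> h \<in> H" using h by simp
  next
    fix h k assume h: "h \<in> H" and k: "k \<in> H"
    have "cube_add (cube_add (cube_add h a) (cube_add k a)) a \<in> A"
      using h k a by (intro ternary_closedD[OF A(1)]) (auto simp: H_def)
    moreover have "cube_add (cube_add (cube_add h a) (cube_add k a)) a = cube_add (cube_add h k) a"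
      using h k ac
      by (auto simp: H_def cube_def cube_add_def ac_simps intro!: nth_equalityI)
    ultimately show "h \<otimes>\<^bsub>?G\<^esub> k \<in> H"
      using h k by (simp add: H_def mul cube_add_closed)
  qed
  \<comment> \<open>Since \<open>x\<close> is its own inverse, membership of \<open>y\<close> in the
    coset of \<open>x\<close> means that \<open>cube_add x y\<close> lies in
    \<open>H\<close>.\<close>
  have coset: "y \<in> H #>\<^bsub>?G\<^esub> x \<longleftrightarrow> y \<in> cube n \<and> cube_add (cube_add x y) a \<in> A"
    if x: "x \<in> cube n" for x y
  proof
    assume "y \<in> H #>\<^bsub>?G\<^esub> x"
    then obtain h where h: "h \<in> cube n" "cube_add h a \<in> A" and y: "y = cube_add h x"
      by (auto simp: r_coset_def mul H_def)
    have "cube_add x y = h"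
      unfolding y using cube_add_commute[OF x h(1)] cube_add_cancel_left[OF x h(1)] by simp
    then show "y \<in> cube n \<and> cube_add (cube_add x y) a \<in> A"
      using h x by (simp add: y cube_add_closed)
  next
    assume y: "y \<in> cube n \<and> cube_add (cube_add x y) a \<in> A"
    then have "y = cube_add (cube_add x y) x"
      using x cube_add_cancel_right[of y n x] cube_add_commute[of x n y] by simp
    moreover have "cube_add x y \<in> H" using x y by (simp add: H_def cube_add_closed)
    ultimately show "y \<in> H #>\<^bsub>?G\<^esub> x" by (auto simp: r_coset_def mul)
  qed
  \<comment> \<open>The sum of two points from the same part acts as a translation preserving both
    parts.\<close>
  have AAB: "cube_add (cube_add x y) z \<in> B" if "x \<in> A" "y \<in> A" "z \<in> B" for x y z
    using ternary_closed_notin[OF A(1,3) that(1,2), of z] that A B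
    by (auto intro!: cube_add_closed)
  have BBA: "cube_add (cube_add x y) z \<in> A" if "x \<in> B" "y \<in> B" "z \<in> A" for x y z
    using ternary_closed_notin[OF B(1) B_sub that(1,2), of z] that A B
    by (auto intro!: cube_add_closed)
  have swap: "cube_add (cube_add x y) a = cube_add (cube_add x a) y"
    if "x \<in> cube n" "y \<in> cube n" for x y
    using that ac by (auto simp: cube_def cube_add_def ac_simps intro!: nth_equalityI)
  have coset_A: "H #>\<^bsub>?G\<^esub> x = A" if x: "x \<in> A" for x
  proof -
    have xc: "x \<in> cube n" using x A by blast
    have "cube_add (cube_add x y) a \<in> A \<longleftrightarrow> y \<in> A" if y: "y \<in> cube n" for y
    proof
      assume "y \<in> A" then show "cube_add (cube_add x y) a \<in> A"
        using A(1) x a by (simp add: ternary_closedD)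
    next
      assume "cube_add (cube_add x y) a \<in> A"
      then have "cube_add (cube_add x a) y \<notin> B" using swap[OF xc y] B(3) by simp
      then show "y \<in> A" using AAB[OF x a, of y] y B(3) by blast
    qed
    then show ?thesis using coset[OF xc] A by blast
  qed
  have coset_B: "H #>\<^bsub>?G\<^esub> x = B" if x: "x \<in> B" for x
  proof -
    have xc: "x \<in> cube n" using x B by blast
    have "cube_add (cube_add x y) a \<in> A \<longleftrightarrow> y \<in> B" if y: "y \<in> cube n" for y
    proof
      assume "y \<in> B" then show "cube_add (cube_add x y) a \<in> A" using BBA x a by blast
    next
      assume L: "cube_add (cube_add x y) a \<in> A"
      have "cube_add (cube_add x y) a = cube_add (cube_add y a) x"
        using xc y ac
        by (auto simp: cube_def cube_add_def ac_simps intro!: nth_equalityI)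
      then have "cube_add (cube_add y a) x \<notin> B" using L B(3) by simp
      then show "y \<in> B" using AAB[OF _ a x, of y] y B(3) by blast
    qed
    then show ?thesis using coset[OF xc] B by blast
  qed
  \<comment> \<open>Every point of the cube is in \<open>A\<close> or in \<open>B\<close>, and its
    coset is the part containing it.\<close>
  have "rcosets\<^bsub>?G\<^esub> H = (\<lambda>x. H #>\<^bsub>?G\<^esub> x) ` (A \<union> B)"
    using A B by (auto simp: RCOSETS_def car)
  also have "\<dots> = {A, B}" using coset_A coset_B a b by (auto simp: image_iff)
  finally have rc: "rcosets\<^bsub>?G\<^esub> H = {A, B}" .
  moreover have "A \<noteq> B" using a B by blast
  ultimately show ?thesis
    using H B(3) unfolding complementary_cosets_index_two_def by (intro exI[of _ H]) simp
qed

section \<open>The equality cases\<close>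

text \<open>Evaluate the convolution at w = x + y. The summand at \<open>x\<close> is f(x) g(y) = 0,
  strictly below f(x), so the upper value is excluded and the convolution vanishes at w. Then every
  summand vanishes; the one at \<open>z\<close> gives g(z + w) = 0, so f(z + w) = 1.\<close>

lemma ternary_closed_supp_if_conv_two_valued:
  assumes f: "\<forall>x\<in>cube n. 0 \<le> f x" and g: "\<forall>x\<in>cube n. g x \<in> {0..1}"
    and prod: "\<forall>x\<in>cube n. f x * g x = 0" and sum: "\<forall>x\<in>cube n. f x + g x = 1"
    and two: "\<forall>z\<in>cube n. cube_conv n f g z = 0 \<or> cube_conv n f g z = cube_expect n f"
  shows "ternary_closed (cube_supp n f)"
  unfolding ternary_closed_def
proof (intro ballI)
  fix x y z assume "x \<in> cube_supp n f" "y \<in> cube_supp n f" "z \<in> cube_supp n f"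
  then have x: "x \<in> cube n" "f x \<noteq> 0" and y: "y \<in> cube n" "f y \<noteq> 0"
    and z: "z \<in> cube n" "f z \<noteq> 0"
    by (auto simp: cube_supp_def)
  let ?w = "cube_add x y"
  have w: "?w \<in> cube n" using x y by (simp add: cube_add_closed)
  have "cube_conv n f g ?w \<noteq> cube_expect n f"
  proof
    assume "cube_conv n f g ?w = cube_expect n f"
    \<comment> \<open>The upper value is attained only if no mass of \<open>f\<close> is lost at any
      point, in particular at \<open>x\<close>.\<close>
    then have "cube_expect n (\<lambda>t. f t - f t * g (cube_add t ?w)) = 0"
      by (simp add: cube_expect_diff cube_conv_def)
    moreover have "0 \<le> f t - f t * g (cube_add t ?w)" if "t \<in> cube n" for t
      using that w f g by (simp add: cube_add_closed mult_left_le)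
    ultimately have "f x - f x * g (cube_add x ?w) = 0"
      using x by (simp only: cube_expect_eq_0_iff)
    moreover have "cube_add x ?w = y" using x y by (simp add: cube_add_cancel_left)
    moreover have "g y = 0" using prod y by auto
    ultimately show False using x by simp
  qed
  then have "cube_expect n (\<lambda>t. f t * g (cube_add t ?w)) = 0"
    using two w by (auto simp: cube_conv_def)
  moreover have "0 \<le> f t * g (cube_add t ?w)" if "t \<in> cube n" for t
    using that w f g by (simp add: cube_add_closed)
  ultimately have "f z * g (cube_add z ?w) = 0"
    using z by (simp only: cube_expect_eq_0_iff)
  then have "g (cube_add ?w z) = 0" using z w by (simp add: cube_add_commute[of z n])
  then show "cube_add ?w z \<in> cube_supp n f"
    using sum w z cube_add_closed[OF w z(1)] by (force simp: cube_supp_def)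
qed

lemma cube_conv_equality_imp:
  assumes f: "\<forall>x\<in>cube n. f x \<in> {0..1}" and g: "\<forall>x\<in>cube n. g x \<in> {0..1}"
    and eq: "cube_norm_sq n (cube_conv n f g)
      = 1 / 2 * (cube_inner n f g + cube_expect n f * cube_expect n g)"
  shows "((\<forall>x\<in>cube n. f x = 0) \<or> (\<forall>x\<in>cube n. g x = 0))
    \<or> (\<forall>x\<in>cube n. f x = 1 \<and> g x = 1)
    \<or> complementary_cosets_index_two n (cube_supp n f) (cube_supp n g)"
proof -
  define \<alpha> \<beta> \<delta> where "\<alpha> = cube_expect n f" and "\<beta> = cube_expect n g" and "\<delta> = cube_inner n f g"
  have f0: "\<forall>x\<in>cube n. 0 \<le> f x" and g0: "\<forall>x\<in>cube n. 0 \<le> g x" using f g by auto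
  have prod0: "0 \<le> (1 - f x) * (1 - g x)" if "x \<in> cube n" for x using f g that by simp
  have a0: "0 \<le> \<alpha>" and b0: "0 \<le> \<beta>" and d0: "0 \<le> \<delta>"
    using f0 g0 by (auto simp: \<alpha>_def \<beta>_def \<delta>_def cube_inner_def intro!: cube_expect_nonneg)
  have a1: "\<alpha> \<le> 1" and b1: "\<beta> \<le> 1"
    using cube_expect_mono[of n f "\<lambda>x. 1"] cube_expect_mono[of n g "\<lambda>x. 1"] f g
    by (auto simp: \<alpha>_def \<beta>_def cube_expect_const)
  have ab: "\<alpha> + \<beta> \<le> 1 + \<delta>"
    using cube_expect_nonneg[of n "\<lambda>x. (1 - f x) * (1 - g x)"] prod0
    by (simp add: cube_expect_one_minus_prod \<alpha>_def \<beta>_def \<delta>_def)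
  have le: "\<delta> + \<alpha> * \<beta> \<le> 2 * (min \<alpha> \<beta> * (\<alpha> * \<beta>))"
    using cube_norm_sq_conv_le[OF f g] eq by (simp add: \<alpha>_def \<beta>_def \<delta>_def)
  show ?thesis
  proof (cases "\<alpha> = 0 \<or> \<beta> = 0")
    case True
    then show ?thesis
      using f0 g0 cube_expect_eq_0_iff[of n f] cube_expect_eq_0_iff[of n g]
      by (auto simp: \<alpha>_def \<beta>_def)
  next
    case False
    then have pos: "0 < \<alpha> * \<beta>" using a0 b0 by auto
    have p1: "\<alpha> * \<beta> \<le> 1" using a0 b0 a1 b1 by (simp add: mult_le_one)
    \<comment> \<open>Twice the minimum is at most \<alpha> + \<beta>, hence at most 1 + \<delta>.
      Comparison with \<open>le\<close> leaves only \<delta> = 0 or \<alpha>\<beta> = 1.\<close>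
    have "2 * min \<alpha> \<beta> * (\<alpha> * \<beta>) \<le> (1 + \<delta>) * (\<alpha> * \<beta>)"
      using pos ab by (intro mult_right_mono) auto
    then have "\<delta> * (1 - \<alpha> * \<beta>) \<le> 0" using le by (simp add: algebra_simps)
    moreover have "0 \<le> \<delta> * (1 - \<alpha> * \<beta>)" using d0 p1 by simp
    ultimately have "\<delta> = 0 \<or> \<alpha> * \<beta> = 1" by auto
    then show ?thesis
    proof
      assume "\<alpha> * \<beta> = 1"
      then have "\<alpha> = 1" "\<beta> = 1"
        using mult_left_le[OF b1 a0] mult_left_le[OF a1 b0] a1 b1 by (simp_all add: mult.commute)
      then have "cube_expect n (\<lambda>x. 1 - f x) = 0" "cube_expect n (\<lambda>x. 1 - g x) = 0"
        by (simp_all add: cube_expect_diff cube_expect_const \<alpha>_def \<beta>_def)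
      then show ?thesis using f g by (simp add: cube_expect_eq_0_iff)
    next
      assume d: "\<delta> = 0"
      \<comment> \<open>Cancelling the positive \<alpha>\<beta> puts both means at 1/2 or above,
        while \<alpha> + \<beta> is at most 1.\<close>
      have "1 \<le> 2 * min \<alpha> \<beta>"
        using le pos mult_le_cancel_right_pos[of "\<alpha> * \<beta>" 1 "2 * min \<alpha> \<beta>"] by (simp add: d)
      then have half: "\<alpha> = 1 / 2" "\<beta> = 1 / 2" using ab d by auto
      have prod: "\<forall>x\<in>cube n. f x * g x = 0"
        using d f0 g0 by (simp add: \<delta>_def cube_inner_def cube_expect_eq_0_iff)
      have "cube_expect n (\<lambda>x. (1 - f x) * (1 - g x)) = 0"
        using half d by (simp add: cube_expect_one_minus_prod \<alpha>_def \<beta>_def \<delta>_def)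
      then have "\<forall>x\<in>cube n. (1 - f x) * (1 - g x) = 0"
        using prod0 by (simp only: cube_expect_eq_0_iff)
      then have sum: "\<forall>x\<in>cube n. f x + g x = 1" using prod by (auto simp: algebra_simps)
      let ?h = "cube_conv n f g"
      \<comment> \<open>Both terms average to 1/8: the first is \<alpha> times \<alpha>\<beta>, the
        second is half of \<alpha>\<beta> by the assumed equality. The integrand is h(\<alpha> - h),
        so \<open>?h\<close> takes only the extreme values.\<close>
      have "cube_expect n (\<lambda>z. \<alpha> * ?h z - (?h z)\<^sup>2) = 0"
        using eq d unfolding cube_expect_diff cube_expect_mult_left cube_expect_conv
          cube_norm_sq_def \<alpha>_def[symmetric] \<beta>_def[symmetric] \<delta>_def[symmetric]
        by (simp add: half)
      moreover have "0 \<le> \<alpha> * ?h z - (?h z)\<^sup>2" if "z \<in> cube n" for z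
        using that f g cube_conv_nonneg[of n f g z] cube_conv_le_left[of n f g z]
        by (simp add: \<alpha>_def power2_eq_square mult_right_mono)
      ultimately have "\<forall>z\<in>cube n. \<alpha> * ?h z - (?h z)\<^sup>2 = 0"
        by (simp only: cube_expect_eq_0_iff)
      then have two: "?h z = 0 \<or> ?h z = \<alpha>" if "z \<in> cube n" for z
        using that by (auto simp: power2_eq_square)
      have cf: "ternary_closed (cube_supp n f)"
        using two by (intro ternary_closed_supp_if_conv_two_valued[OF f0 g prod sum])
          (auto simp: \<alpha>_def)
      \<comment> \<open>The roles of \<open>f\<close> and \<open>g\<close> can be exchanged:
        convolution is symmetric and the two means agree.\<close>
      have cg: "ternary_closed (cube_supp n g)"
        using two prod sum half(2)[folded half(1)]
        by (intro ternary_closed_supp_if_conv_two_valued[OF g0 f])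
          (auto simp: \<beta>_def[symmetric] cube_conv_commute add.commute mult.commute)
      have ne: "cube_supp n f \<noteq> {}" "cube_supp n g \<noteq> {}"
        using half f0 g0 cube_expect_eq_0_iff[of n f] cube_expect_eq_0_iff[of n g]
        by (auto simp: cube_supp_def \<alpha>_def \<beta>_def)
      have "cube_supp n g = cube n - cube_supp n f"
        using prod sum by (force simp: cube_supp_def)
      then show ?thesis
        using complementary_cosets_index_twoI[OF cf ne(1) _ cg ne(2)] by (auto simp: cube_supp_def)
    qed
  qed
qed

text \<open>Both supports have density 1/2 and are disjoint, and the convolution h takes only the
  values 0 and 1/2. Hence h^2 = h/2 pointwise, and the mean of h finishes the computation.\<close>

lemma cube_conv_equality_if_complementary_cosets:
  assumes f: "\<forall>x\<in>cube n. f x \<in> {0, 1}" and g: "\<forall>x\<in>cube n. g x \<in> {0, 1}"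
    and cosets: "complementary_cosets_index_two n (cube_supp n f) (cube_supp n g)"
  shows "cube_norm_sq n (cube_conv n f g)
    = 1 / 2 * (cube_inner n f g + cube_expect n f * cube_expect n g)"
proof -
  let ?A = "cube_supp n f" and ?B = "cube_supp n g" and ?h = "cube_conv n f g"
  have A: "ternary_closed ?A" "?A \<subseteq> cube n" and B: "ternary_closed ?B" "?B \<subseteq> cube n"
    and ne: "?A \<noteq> {}" "?B \<noteq> {}" and compl: "?B = cube n - ?A"
    using complementary_cosets_index_two_imp_ternary_closed[OF cosets] by auto
  have f_iff: "f x = (if x \<in> ?A then 1 else 0)" if "x \<in> cube n" for x
    using that f by (auto simp: cube_supp_def)
  have g_iff: "g x = (if x \<in> ?A then 0 else 1)" if "x \<in> cube n" for x
  proof -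
    have "g x = (if x \<in> ?B then 1 else 0)" using that g by (auto simp: cube_supp_def)
    then show ?thesis using compl that by simp
  qed
  obtain a b where a: "a \<in> ?A" and b: "b \<in> ?B" using ne by blast
  have ac: "a \<in> cube n" and bc: "b \<in> cube n" using a b A B by auto
  \<comment> \<open>Inserting a + a = 0 writes the shift of \<open>x\<close> by \<open>z\<close> as
    a ternary sum, so the part containing \<open>cube_add a z\<close> decides what the shift does to
    \<open>?A\<close>.\<close>
  have shift: "cube_add x z = cube_add (cube_add x a) (cube_add a z)"
    if "x \<in> cube n" "z \<in> cube n" for x z
    using that ac by (simp add: cube_add_assoc cube_add_cancel_left cube_add_closed)
  have "cube_expect n g = cube_expect n (\<lambda>x. g (cube_add x (cube_add a b)))"
    using ac bc by (simp add: cube_expect_translate cube_add_closed)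
  also have "\<dots> = cube_expect n f"
  proof (rule cube_expect_cong)
    fix x assume x: "x \<in> cube n"
    have eq: "cube_add x (cube_add a b) = cube_add (cube_add x a) b"
      "cube_add x (cube_add a b) = cube_add (cube_add x b) a"
      using x ac bc by (simp_all add: cube_add_assoc cube_add_commute[of a n b])
    have w: "cube_add x (cube_add a b) \<in> cube n" using x ac bc by (simp add: cube_add_closed)
    \<comment> \<open>Translation by a + b exchanges the two parts: for \<open>x\<close> in
      \<open>?A\<close> the sum x + a preserves \<open>?B\<close>, which contains \<open>b\<close>;
      for \<open>x\<close> in \<open>?B\<close> the sum x + b preserves \<open>?A\<close>, which
      contains \<open>a\<close>.\<close>
    have "cube_add x (cube_add a b) \<in> ?A \<longleftrightarrow> x \<notin> ?A"
    proof (cases "x \<in> ?A")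
      case True
      then show ?thesis
        using ternary_closed_notin[OF A True a bc] b compl eq(1) by auto
    next
      case False
      then have "x \<in> ?B" using x compl by blast
      then show ?thesis
        using ternary_closed_notin[OF B _ b ac, of x] a w compl False eq(2) by auto
    qed
    then show "g (cube_add x (cube_add a b)) = f x"
      using f_iff[OF x] g_iff[OF w] by simp
  qed
  finally have gf: "cube_expect n g = cube_expect n f" .
  have "cube_expect n (\<lambda>x. f x + g x) = cube_expect n (\<lambda>x. 1)"
    by (rule cube_expect_cong) (simp add: f_iff g_iff)
  then have half: "cube_expect n f = 1 / 2" "cube_expect n g = 1 / 2"
    using gf by (simp_all add: cube_expect_add cube_expect_const)
  have "cube_inner n f g = cube_expect n (\<lambda>x. 0)"
    unfolding cube_inner_def by (rule cube_expect_cong) (simp add: f_iff g_iff)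
  then have inner: "cube_inner n f g = 0" by (simp add: cube_expect_const)
  \<comment> \<open>If \<open>cube_add a z\<close> is in \<open>?A\<close>, the shift maps
    \<open>?A\<close> into itself, where \<open>g\<close> vanishes; otherwise it maps
    \<open>?A\<close> into \<open>?B\<close>, where \<open>g\<close> is 1.\<close>
  have "?h z = 0 \<or> ?h z = 1 / 2" if z: "z \<in> cube n" for z
  proof (cases "cube_add a z \<in> ?A")
    case True
    have "f x * g (cube_add x z) = 0" if x: "x \<in> cube n" for x
      using ternary_closedD[OF A(1) _ a True, of x] shift[OF x z]
        f_iff[OF x] g_iff[OF cube_add_closed[OF x z]] by auto
    then have "?h z = cube_expect n (\<lambda>x. 0)"
      unfolding cube_conv_def by (intro cube_expect_cong)
    then show ?thesis by (simp add: cube_expect_const)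
  next
    case False
    have "f x * g (cube_add x z) = f x" if x: "x \<in> cube n" for x
      using ternary_closed_notin[OF A _ a cube_add_closed[OF ac z] False, of x] shift[OF x z]
        f_iff[OF x] g_iff[OF cube_add_closed[OF x z]] by auto
    then have "?h z = cube_expect n f"
      unfolding cube_conv_def by (intro cube_expect_cong)
    then show ?thesis by (simp add: half)
  qed
  then have "cube_norm_sq n ?h = cube_expect n (\<lambda>z. 1 / 2 * ?h z)"
    unfolding cube_norm_sq_def by (intro cube_expect_cong) (auto simp: power2_eq_square)
  also have "\<dots> = 1 / 2 * (cube_expect n f * cube_expect n g)"
    by (simp only: cube_expect_mult_left cube_expect_conv)
  finally show ?thesis using inner by simp
qed

section \<open>The inequality and the assembly of the equality cases\<close>

theorem lemma2p2:
  fixes n :: nat and f g :: "bit list \<Rightarrow> real"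
  assumes f: "\<forall>x\<in>cube n. f x \<in> {0..1}"
    and g: "\<forall>x\<in>cube n. g x \<in> {0..1}"
  shows "cube_norm_sq n (cube_conv n f g)
           \<le> 1 / 2 * (cube_inner n f g + cube_expect n f * cube_expect n g)
       \<and> ((\<forall>x\<in>cube n. f x \<in> {0, 1}) \<and> (\<forall>x\<in>cube n. g x \<in> {0, 1}) \<longrightarrow>
          (cube_norm_sq n (cube_conv n f g)
             = 1 / 2 * (cube_inner n f g + cube_expect n f * cube_expect n g)
           \<longleftrightarrow> ((\<forall>x\<in>cube n. f x = 0) \<or> (\<forall>x\<in>cube n. g x = 0))
             \<or> (\<forall>x\<in>cube n. f x = 1 \<and> g x = 1)
             \<or> complementary_cosets_index_two n (cube_supp n f) (cube_supp n g)))"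
    (is "?L \<le> ?R \<and> (?Bool \<longrightarrow> (?L = ?R \<longleftrightarrow> ?Z \<or> ?O \<or> ?C))")
proof (intro conjI impI iffI)
  let ?\<alpha> = "cube_expect n f" and ?\<beta> = "cube_expect n g" and ?\<delta> = "cube_inner n f g"
  have a0: "0 \<le> ?\<alpha>" and b0: "0 \<le> ?\<beta>" and d0: "0 \<le> ?\<delta>"
    using f g by (auto simp: cube_inner_def intro!: cube_expect_nonneg)
  have a1: "?\<alpha> \<le> 1" and b1: "?\<beta> \<le> 1"
    using cube_expect_mono[of n f "\<lambda>x. 1"] cube_expect_mono[of n g "\<lambda>x. 1"] f g
    by (auto simp: cube_expect_const)
  have "?\<alpha> + ?\<beta> \<le> 1 + ?\<delta>"
    using cube_expect_nonneg[of n "\<lambda>x. (1 - f x) * (1 - g x)"] f g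
    by (simp add: cube_expect_one_minus_prod)
  then have m: "min ?\<alpha> ?\<beta> \<le> (1 + ?\<delta>) / 2" by auto
  have "?L \<le> min ?\<alpha> ?\<beta> * (?\<alpha> * ?\<beta>)" by (rule cube_norm_sq_conv_le[OF f g])
  also have "\<dots> \<le> (1 + ?\<delta>) / 2 * (?\<alpha> * ?\<beta>)"
    using m a0 b0 by (intro mult_right_mono) auto
  also have "\<dots> = (?\<delta> * (?\<alpha> * ?\<beta>) + ?\<alpha> * ?\<beta>) / 2" by (simp add: algebra_simps)
  \<comment> \<open>The product of the means is at most 1, so multiplying \<delta> by it does not
    increase \<delta>.\<close>
  also have "\<dots> \<le> ?R" using mult_left_le[of "?\<alpha> * ?\<beta>" ?\<delta>] d0 a0 b0 a1 b1 by (simp add: mult_le_one)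
  finally show "?L \<le> ?R" .
next
  assume "?L = ?R"
  then show "?Z \<or> ?O \<or> ?C" by (rule cube_conv_equality_imp[OF f g])
next
  assume bool: ?Bool and "?Z \<or> ?O \<or> ?C"
  then consider ?Z | ?O | ?C by blast
  then show "?L = ?R"
  proof cases
    case 1
    then have inner: "cube_inner n f g = 0"
      by (auto simp: cube_inner_def cube_expect_eq_sum)
    have "cube_expect n f = 0 \<or> cube_expect n g = 0" using 1 by (auto simp: cube_expect_eq_sum)
    moreover have "cube_norm_sq n (cube_conv n f g) = cube_expect n (\<lambda>z. 0)"
      unfolding cube_norm_sq_def cube_conv_def
      using 1 by (intro cube_expect_cong) (auto simp: cube_expect_eq_sum cube_add_closed)
    ultimately show ?thesis using inner by (auto simp: cube_expect_const)
  next
    case 2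
    have "cube_expect n f = cube_expect n (\<lambda>x. 1)" "cube_expect n g = cube_expect n (\<lambda>x. 1)"
      "cube_inner n f g = cube_expect n (\<lambda>x. 1)"
      unfolding cube_inner_def using 2 by (auto intro!: cube_expect_cong)
    moreover have "cube_conv n f g z = cube_expect n (\<lambda>x. 1)" if "z \<in> cube n" for z
      unfolding cube_conv_def using 2 that by (intro cube_expect_cong) (simp add: cube_add_closed)
    then have "cube_norm_sq n (cube_conv n f g) = cube_expect n (\<lambda>z. 1)"
      unfolding cube_norm_sq_def by (intro cube_expect_cong) (simp add: cube_expect_const)
    ultimately show ?thesis by (simp add: cube_expect_const)
  next
    case 3
    then show ?thesis using bool by (intro cube_conv_equality_if_complementary_cosets) auto
  qed
qed

end
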